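(* For $i=1,2$ let $(p_{n_i})_{n_i\ge 1}$ and $(q_{n_i})_{n_i\ge 1}$ be real sequences with $0<q_{n_i}<p_{n_i}\le 1$ and $p_{n_i}\to 1$, $q_{n_i}\to 1$ as $n_i\to\infty$. Let $\omega$ be a function of modulus-of-continuity type, and let $A_{n_1,n_2}=A_{n_1,n_2}^{(p_{n_1},p_{n_2}),(q_{n_1},q_{n_2})}$ ($n_1,n_2\ge 1$) be a sequence of positive linear operators from $H_\omega(\mathbb{R}_+^2)$ into $C_B(\mathbb{R}_+^2)$ (in the sense explained in the context) such that (i) $\lim_{n_1,n_2\to\infty}\|A_{n_1,n_2}(e_{00})-e_{00}\|_{C_B(\mathbb{R}_+^2)}=0$, (ii) $\lim_{n_1,n_2\to\infty}\|A_{n_1,n_2}(e_{10})-e_{10}\|_{C_B(\mathbb{R}_+^2)}=0$, (iii) $\lim_{n_1,n_2\to\infty}\|A_{n_1,n_2}(e_{01})-e_{01}\|_{C_B(\mathbb{R}_+^2)}=0$, (iv) $\lim_{n_1,n_2\to\infty}\|A_{n_1,n_2}(e_{20})-e_{20}\|_{C_B(\mathbb{R}_+^2)}=0$, (v) $\lim_{n_1,n_2\to\infty}\|A_{n_1,n_2}(e_{02})-e_{02}\|_{C_B(\mathbb{R}_+^2)}=0$. Then for every $f\in H_\omega(\mathbb{R}_+^2)$, $$\lim_{n_1,n_2\to\infty}\|A_{n_1,n_2}(f)-f\|_{C_B(\mathbb{R}_+^2)}=0.$$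
   Context: $\mathbb{R}_+=[0,\infty)$ and $\mathbb{R}_+^2=[0,\infty)\times[0,\infty)$. $C_B(\mathbb{R}_+^2)$ is the space of bounded continuous real functions on $\mathbb{R}_+^2$ with norm $\|f\|_{C_B(\mathbb{R}_+^2)}=\sup_{x,y\ge 0}|f(x,y)|$. A function of modulus-of-continuity type is a function $\omega$ such that: (a) $\omega$ is a non-negative increasing function on $\mathbb{R}_+$; (b) $\omega(\delta_1+\delta_2)\le\omega(\delta_1)+\omega(\delta_2)$; (c) $\lim_{\delta\to 0}\omega(\delta)=0$. $H_\omega(\mathbb{R}_+^2)$ is the set of real-valued functions $f$ on $\mathbb{R}_+^2$ such that for all $(u,v),(x,y)\in\mathbb{R}_+^2$ $$|f(u,v)-f(x,y)|\le\omega\left(\left|\left(\tfrac{u}{1+u},\tfrac{v}{1+v}\right)-\left(\tfrac{x}{1+x},\tfrac{y}{1+y}\right)\right|\right),$$ where $|\cdot|$ on the right is the Euclidean norm on $\mathbb{R}^2$. One has $H_\omega(\mathbb{R}_+^2)\subset C_B(\mathbb{R}_+^2)$. Test functions: $e_{ij}(u,v)=\left(\frac{u}{1+u}\right)^i\left(\frac{v}{1+v}\right)^j$ on $\mathbb{R}_+^2$. Since $H_\omega(\mathbb{R}_+^2)$ need not be a linear space, "positive linear operators from $H_\omega(\mathbb{R}_+^2)$ into $C_B(\mathbb{R}_+^2)$" means: linear maps $A_{n_1,n_2}:D\to C_B(\mathbb{R}_+^2)$ defined on a linear subspace $D$ of $C_B(\mathbb{R}_+^2)$ that contains $H_\omega(\mathbb{R}_+^2)$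 and $e_{00},e_{10},e_{01},e_{20},e_{02}$, such that $A_{n_1,n_2}(g)\ge 0$ whenever $g\in D$, $g\ge 0$. The superscripts $p_{n_i},q_{n_i}$ only label the operators. The limit $n_1,n_2\to\infty$ is the joint limit in which both indices tend to infinity. *)

theory Defs
  imports "HOL-Analysis.Analysis"
begin

typedef nnreal = "{0::real..}"
  morphisms real_of_nnreal nnreal_of_real
  by auto

lemma real_of_nnreal_nonneg [simp]: "0 \<le> real_of_nnreal u"
  using real_of_nnreal[of u] by simp

instantiation nnreal :: metric_space
begin

definition dist_nnreal :: "nnreal \<Rightarrow> nnreal \<Rightarrow> real"
  where "dist_nnreal u v = dist (real_of_nnreal u) (real_of_nnreal v)"

definition uniformity_nnreal :: "(nnreal \<times> nnreal) filter"
  where "uniformity_nnreal = (INF e\<in>{0<..}. principal {(x, y). dist x y < e})"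

definition open_nnreal :: "nnreal set \<Rightarrow> bool"
  where "open_nnreal U \<longleftrightarrow> (\<forall>x\<in>U. eventually (\<lambda>(x', y). x' = x \<longrightarrow> y \<in> U) uniformity)"

instance
proof
  fix x y z :: nnreal
  show "dist x y = 0 \<longleftrightarrow> x = y"
    by (simp add: dist_nnreal_def real_of_nnreal_inject)
  show "dist x y \<le> dist x z + dist y z"
    unfolding dist_nnreal_def by (rule dist_triangle2)
qed (fact uniformity_nnreal_def open_nnreal_def)+

end

lemma continuous_on_real_of_nnreal: "continuous_on S real_of_nnreal"
  unfolding continuous_on_iff dist_nnreal_def by blast

text \<open>
  The space of bounded continuous real functions on the closed quadrant, with the supremum norm.
\<close>
type_synonym CB = "(nnreal \<times> nnreal) \<Rightarrow>\<^sub>C real"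

definition squash :: "nnreal \<Rightarrow> real"
  where "squash u = real_of_nnreal u / (1 + real_of_nnreal u)"

lemma squash_nonneg: "0 \<le> squash u"
  by (simp add: squash_def)

lemma squash_le_1: "squash u \<le> 1"
  using real_of_nnreal_nonneg[of u] by (simp add: squash_def divide_le_eq del: real_of_nnreal_nonneg)

lemma squash_power_bounds: "0 \<le> squash u ^ i" "squash u ^ i \<le> 1"
  by (simp_all add: squash_nonneg squash_le_1 power_le_one)

lemma one_plus_real_of_nnreal_neq_0: "1 + real_of_nnreal u \<noteq> 0"
  using real_of_nnreal_nonneg[of u] by linarith

lemma continuous_on_squash: "continuous_on S squash"
  unfolding squash_def
  by (intro continuous_intros continuous_on_real_of_nnreal) (simp add: one_plus_real_of_nnreal_neq_0)

definition test_fun :: "nat \<Rightarrow> nat \<Rightarrow> CB"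
  where "test_fun i j = Bcontfun (\<lambda>(u, v). squash u ^ i * squash v ^ j)"

lemma apply_test_fun: "apply_bcontfun (test_fun i j) (u, v) = squash u ^ i * squash v ^ j"
proof -
  let ?f = "\<lambda>(u, v). squash u ^ i * squash v ^ j"
  have "continuous_on UNIV (\<lambda>x. squash (fst x) ^ i * squash (snd x) ^ j)"
    by (intro continuous_intros continuous_on_compose2[OF continuous_on_squash[of UNIV]]) auto
  moreover have "norm (?f x) \<le> 1" for x
    by (cases x) (simp add: abs_mult squash_power_bounds squash_nonneg mult_le_one)
  then have "bounded (range ?f)"
    unfolding bounded_iff by blast
  ultimately have "?f \<in> bcontfun"
    by (simp add: bcontfun_def case_prod_unfold)
  then show ?thesis
    by (simp add: test_fun_def Bcontfun_inverse)
qed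

text \<open>``Increasing'' is understood in the weak sense; values of \<open>\<omega>\<close> at negative reals are
  irrelevant.\<close>
definition modulus_type :: "(real \<Rightarrow> real) \<Rightarrow> bool"
  where "modulus_type \<omega> \<longleftrightarrow>
    (\<forall>\<delta>\<ge>0. 0 \<le> \<omega> \<delta>) \<and> mono_on {0..} \<omega> \<and>
    (\<forall>\<delta>\<^sub>1\<ge>0. \<forall>\<delta>\<^sub>2\<ge>0. \<omega> (\<delta>\<^sub>1 + \<delta>\<^sub>2) \<le> \<omega> \<delta>\<^sub>1 + \<omega> \<delta>\<^sub>2) \<and>
    (\<omega> \<longlongrightarrow> 0) (at 0 within {0..})"

text \<open>The norm of a pair in \<^typ>\<open>real \<times> real\<close> is the Euclidean norm (\<open>norm_Pair\<close>).\<close>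
definition H :: "(real \<Rightarrow> real) \<Rightarrow> (nnreal \<times> nnreal \<Rightarrow> real) set"
  where "H \<omega> = {f. \<forall>u v x y.
    \<bar>f (u, v) - f (x, y)\<bar> \<le> \<omega> (norm ((squash u, squash v) - (squash x, squash y)))}"

text \<open>This inclusion makes \<^const>\<open>Bcontfun\<close>, the injection of bounded continuous functions
  into \<^typ>\<open>CB\<close>, meaningful on \<^term>\<open>H \<omega>\<close>.\<close>
lemma H_subset_bcontfun:
  assumes "modulus_type \<omega>"
  shows "H \<omega> \<subseteq> bcontfun"
proof
  fix f assume "f \<in> H \<omega>"
  let ?g = "\<lambda>x. (squash (fst x), squash (snd x))"
  have H: "\<bar>f a - f b\<bar> \<le> \<omega> (dist (?g a) (?g b))" for a b
    using \<open>f \<in> H \<omega>\<close> by (cases a; cases b) (simp add: H_def dist_norm)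
  have nn: "0 \<le> \<omega> d" if "0 \<le> d" for d
    using assms that by (simp add: modulus_type_def)
  have mono: "\<omega> c \<le> \<omega> d" if "0 \<le> c" "c \<le> d" for c d
    using assms that by (auto simp: modulus_type_def mono_on_def)
  have lim: "(\<omega> \<longlongrightarrow> 0) (at 0 within {0..})"
    using assms by (simp add: modulus_type_def)
  have g: "continuous_on UNIV ?g"
    by (intro continuous_intros continuous_on_compose2[OF continuous_on_squash[of UNIV]]) auto
  have "continuous_on UNIV f"
    unfolding continuous_on_iff
  proof (intro ballI allI impI)
    fix a :: "nnreal \<times> nnreal" and e :: real assume "0 < e"
    then obtain d where "0 < d"
      and "\<forall>t\<in>{0..}. 0 < dist t 0 \<and> dist t 0 < d \<longrightarrow> dist (\<omega> t) 0 < e"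
      using lim unfolding Lim_within by blast
    then have d: "0 < d" "0 < t \<Longrightarrow> t < d \<Longrightarrow> \<omega> t < e" for t
      by (auto simp: dist_real_def)
    have "\<omega> t < e" if "0 \<le> t" "t < d" for t
    proof -
      have "\<omega> t \<le> \<omega> ((t + d) / 2)"
        using that by (intro mono) auto
      also have "\<dots> < e"
        using that d(1) by (intro d(2)) auto
      finally show ?thesis .
    qed
    moreover obtain r where "0 < r" "\<And>b. dist b a < r \<Longrightarrow> dist (?g b) (?g a) < d"
      using g[unfolded continuous_on_iff, rule_format, of a d] d(1) by auto
    moreover have "dist (f b) (f a) \<le> \<omega> (dist (?g b) (?g a))" for b
      using H[of b a] by (simp only: dist_real_def)
    ultimately show "\<exists>r>0. \<forall>b\<in>UNIV. dist b a < r \<longrightarrow> dist (f b) (f a) < e"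
      by (intro exI[of _ r]) (blast intro: le_less_trans zero_le_dist)
  qed
  moreover have "bounded (range f)"
  proof -
    define a :: "nnreal \<times> nnreal" where "a = undefined"
    have "dist (f a) (f b) \<le> \<omega> 2" for b
    proof -
      have "dist (squash (fst a)) (squash (fst b)) \<le> 1" "dist (squash (snd a)) (squash (snd b)) \<le> 1"
        using squash_nonneg[of "fst a"] squash_le_1[of "fst a"] squash_nonneg[of "fst b"]
          squash_le_1[of "fst b"] squash_nonneg[of "snd a"] squash_le_1[of "snd a"]
          squash_nonneg[of "snd b"] squash_le_1[of "snd b"]
        by (auto simp: dist_real_def abs_le_iff)
      then have "dist (?g a) (?g b) \<le> 2"
        unfolding dist_Pair_Pair
        by (intro order_trans[OF sqrt_sum_squares_le_sum_abs]) auto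
      then show ?thesis
        using H[of a b] mono[of "dist (?g a) (?g b)" 2] by (simp add: dist_real_def)
    qed
    then show ?thesis
      by (auto simp: bounded_def)
  qed
  ultimately show "f \<in> bcontfun"
    by (simp add: bcontfun_def)
qed

text \<open>A linear map defined on the subspace \<open>D\<close> is a total function of which only the values on
  \<open>D\<close> are used.\<close>
definition pos_linear_on :: "CB set \<Rightarrow> (CB \<Rightarrow> CB) \<Rightarrow> bool"
  where "pos_linear_on D T \<longleftrightarrow>
    (\<forall>f\<in>D. \<forall>g\<in>D. T (f + g) = T f + T g) \<and>
    (\<forall>c. \<forall>f\<in>D. T (c *\<^sub>R f) = c *\<^sub>R T f) \<and>
    (\<forall>g\<in>D. (\<forall>x. 0 \<le> apply_bcontfun g x) \<longrightarrow> (\<forall>x. 0 \<le> apply_bcontfun (T g) x))"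

end

theory Submission
  imports Defs
begin

text \<open>
  Write \<open>s(u) = u / (1 + u)\<close>. On the bounded range of \<open>s\<close> the modulus satisfies
  \<open>\<omega> t \<le> \<epsilon> + K t\<^sup>2\<close>, so every \<open>f \<in> H \<omega>\<close> obeys, for each fixed \<open>(x, y)\<close>,
  \<open>\<bar>f(u, v) - f(x, y)\<bar> \<le> \<epsilon> + K ((s(u) - s(x))\<^sup>2 + (s(v) - s(y))\<^sup>2)\<close>. The right-hand side is a
  combination of the five test functions with coefficients bounded uniformly in \<open>(x, y)\<close>. Applying
  a positive operator and evaluating at \<open>(x, y)\<close> bounds \<open>A f - f\<close> by \<open>\<epsilon>\<close> plus a constant multiple
  of the errors on the test functions.
\<close>

text \<open>Near \<open>0\<close> the limit condition gives \<omega> t < \<epsilon>. Away from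
  \<open>0\<close>, monotonicity caps \<omega> t by \<omega> c, while t squared is bounded below
  there, so a large \<open>K\<close> absorbs the cap.\<close>

lemma modulus_type_le_quadratic:
  assumes \<omega>: "modulus_type \<omega>" and "0 < \<epsilon>"
  shows "\<exists>K\<ge>0. \<forall>t. 0 \<le> t \<longrightarrow> t \<le> c \<longrightarrow> \<omega> t \<le> \<epsilon> + K * t\<^sup>2"
proof (cases "0 \<le> c")
  case False
  then show ?thesis by (intro exI[of _ 0]) auto
next
  case True
  have mono: "\<omega> s \<le> \<omega> t" if "0 \<le> s" "s \<le> t" for s t
    using \<omega> that by (auto simp: modulus_type_def mono_on_def)
  have nonneg: "0 \<le> \<omega> t" if "0 \<le> t" for t
    using \<omega> that by (simp add: modulus_type_def)
  have "(\<omega> \<longlongrightarrow> 0) (at 0 within {0..})"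
    using \<omega> by (simp add: modulus_type_def)
  then obtain \<delta> where "0 < \<delta>"
    and "\<forall>t\<in>{0..}. 0 < dist t 0 \<and> dist t 0 < \<delta> \<longrightarrow> dist (\<omega> t) 0 < \<epsilon>"
    using \<open>0 < \<epsilon>\<close> unfolding Lim_within by blast
  then have \<delta>: "\<omega> t < \<epsilon>" if "0 < t" "t < \<delta>" for t
    using that by (auto simp: dist_real_def)
  \<comment> \<open>Chosen so that the quadratic term already reaches \<omega> c at t = \<delta> /
    2.\<close>
  define K where "K = \<omega> c / (\<delta> / 2)\<^sup>2"
  have "0 \<le> K"
    using nonneg True by (simp add: K_def)
  moreover have "\<omega> t \<le> \<epsilon> + K * t\<^sup>2" if "0 \<le> t" "t \<le> c" for t
  proof (cases "t \<le> \<delta> / 2")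
    case True
    \<comment> \<open>The limit says nothing about \<omega> at \<open>0\<close> itself; comparison
      with the positive point \<delta> / 2 covers t = 0 as well.\<close>
    then have "\<omega> t \<le> \<omega> (\<delta> / 2)"
      using that by (intro mono)
    also have "\<dots> < \<epsilon>"
      using \<open>0 < \<delta>\<close> by (intro \<delta>) auto
    finally show ?thesis
      using \<open>0 \<le> K\<close> by (simp add: add_increasing2 less_imp_le)
  next
    case False
    have "\<omega> t \<le> \<omega> c"
      using that by (intro mono)
    also have "\<omega> c = K * (\<delta> / 2)\<^sup>2"
      using \<open>0 < \<delta>\<close> by (simp add: K_def)
    also have "\<dots> \<le> K * t\<^sup>2"
      using False \<open>0 \<le> K\<close> \<open>0 < \<delta>\<close> by (intro mult_left_mono power_mono) auto
    finally show ?thesis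
      using \<open>0 < \<epsilon>\<close> by simp
  qed
  ultimately show ?thesis by blast
qed

text \<open>Values of \<open>squash\<close> lie in [0, 1], so the Euclidean distance is at most 2
  and the previous lemma applies with \<open>c = 2\<close>. Squaring the norm removes the root. One
  \<open>K\<close> serves all pairs of points.\<close>

lemma H_quadratic_bound:
  assumes \<omega>: "modulus_type \<omega>" and f: "f \<in> H \<omega>" and "0 < \<epsilon>"
  shows "\<exists>K\<ge>0. \<forall>u v x y. \<bar>f (u, v) - f (x, y)\<bar>
    \<le> \<epsilon> + K * ((squash u - squash x)\<^sup>2 + (squash v - squash y)\<^sup>2)"
proof -
  obtain K where "0 \<le> K" and K: "\<And>t. 0 \<le> t \<Longrightarrow> t \<le> 2 \<Longrightarrow> \<omega> t \<le> \<epsilon> + K * t\<^sup>2"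
    using modulus_type_le_quadratic[OF \<omega> \<open>0 < \<epsilon>\<close>, of 2] by blast
  have "\<bar>f (u, v) - f (x, y)\<bar> \<le> \<epsilon> + K * ((squash u - squash x)\<^sup>2 + (squash v - squash y)\<^sup>2)"
    for u v x y
  proof -
    let ?a = "squash u - squash x" and ?b = "squash v - squash y"
    define t where "t = norm ((squash u, squash v) - (squash x, squash y))"
    have t: "t = sqrt (?a\<^sup>2 + ?b\<^sup>2)"
      by (simp add: t_def norm_Pair)
    have "\<bar>?a\<bar> \<le> 1" "\<bar>?b\<bar> \<le> 1"
      using squash_nonneg[of u] squash_le_1[of u] squash_nonneg[of v] squash_le_1[of v]
        squash_nonneg[of x] squash_le_1[of x] squash_nonneg[of y] squash_le_1[of y] by auto
    then have "t \<le> 2"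
      unfolding t by (intro order_trans[OF sqrt_sum_squares_le_sum_abs]) auto
    have "\<bar>f (u, v) - f (x, y)\<bar> \<le> \<omega> t"
      using f by (simp only: H_def t_def mem_Collect_eq)
    also have "\<dots> \<le> \<epsilon> + K * t\<^sup>2"
      using \<open>t \<le> 2\<close> by (intro K) (simp_all add: t_def)
    also have "t\<^sup>2 = ?a\<^sup>2 + ?b\<^sup>2"
      by (simp add: t)
    finally show ?thesis .
  qed
  with \<open>0 \<le> K\<close> show ?thesis by blast
qed

lemma
  assumes "pos_linear_on D T"
  shows pos_linear_on_add: "f \<in> D \<Longrightarrow> g \<in> D \<Longrightarrow> T (f + g) = T f + T g"
    and pos_linear_on_scaleR: "f \<in> D \<Longrightarrow> T (c *\<^sub>R f) = c *\<^sub>R T f"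
    and pos_linear_on_nonneg:
      "g \<in> D \<Longrightarrow> (\<And>x. 0 \<le> apply_bcontfun g x) \<Longrightarrow> 0 \<le> apply_bcontfun (T g) x"
  using assms unfolding pos_linear_on_def by blast+

lemma pos_linear_on_diff:
  assumes "pos_linear_on D T" "subspace D" "f \<in> D" "g \<in> D"
  shows "T (f - g) = T f - T g"
  using pos_linear_on_add[OF assms(1) assms(3) subspace_scale[OF assms(2,4)], of "-1"]
    pos_linear_on_scaleR[OF assms(1,4), of "-1"] by simp

text \<open>Positivity is applied to \<open>g - f\<close> and \<open>g + f\<close>, which lie in the
  subspace \<open>D\<close>, whereas the absolute value of \<open>f\<close> need not.\<close>

lemma pos_linear_on_abs_le:
  assumes T: "pos_linear_on D T" and D: "subspace D" and "f \<in> D" "g \<in> D"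
    and le: "\<And>w. \<bar>apply_bcontfun f w\<bar> \<le> apply_bcontfun g w"
  shows "\<bar>apply_bcontfun (T f) w\<bar> \<le> apply_bcontfun (T g) w"
proof -
  have "0 \<le> apply_bcontfun (g - f) x" "0 \<le> apply_bcontfun (g + f) x" for x
    using le[of x] by (simp_all add: minus_bcontfun.rep_eq plus_bcontfun.rep_eq)
  then have "0 \<le> apply_bcontfun (T (g - f)) w" "0 \<le> apply_bcontfun (T (g + f)) w"
    using subspace_diff[OF D assms(4,3)] subspace_add[OF D assms(4,3)]
    by (auto intro: pos_linear_on_nonneg[OF T])
  then show ?thesis
    using pos_linear_on_diff[OF T D assms(4,3)] pos_linear_on_add[OF T assms(4,3)]
    by (simp add: minus_bcontfun.rep_eq plus_bcontfun.rep_eq abs_le_iff)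
qed

text \<open>A quantitative form for a single operator: the factor in front of the errors depends
  only on \<epsilon>, \<open>K\<close> and \<open>norm F\<close>, not on \<open>T\<close>, so it
  stays fixed when \<open>T\<close> runs through a family.\<close>

lemma pos_linear_on_korovkin_estimate:
  assumes T: "pos_linear_on D T" and D: "subspace D" and F: "F \<in> D"
    and e: "test_fun 0 0 \<in> D" "test_fun 1 0 \<in> D" "test_fun 0 1 \<in> D"
      "test_fun 2 0 \<in> D" "test_fun 0 2 \<in> D"
    and "0 \<le> \<epsilon>" "0 \<le> K"
    and le: "\<And>u v x y. \<bar>apply_bcontfun F (u, v) - apply_bcontfun F (x, y)\<bar>
      \<le> \<epsilon> + K * ((squash u - squash x)\<^sup>2 + (squash v - squash y)\<^sup>2)"
  shows "norm (T F - F) \<le> \<epsilon> + (\<epsilon> + 2 * K + norm F) *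
    (norm (T (test_fun 0 0) - test_fun 0 0) + norm (T (test_fun 1 0) - test_fun 1 0)
      + norm (T (test_fun 0 1) - test_fun 0 1) + norm (T (test_fun 2 0) - test_fun 2 0)
      + norm (T (test_fun 0 2) - test_fun 0 2))"
    (is "_ \<le> _ + ?C * ?S")
proof (rule norm_bound)
  fix z :: "nnreal \<times> nnreal"
  obtain x y where z: "z = (x, y)" by fastforce
  define a b where "a = squash x" and "b = squash y"
  have ab: "0 \<le> a" "a \<le> 1" "0 \<le> b" "b \<le> 1"
    by (simp_all add: a_def b_def squash_nonneg squash_le_1)
  define \<eta> where "\<eta> i j = norm (T (test_fun i j) - test_fun i j)" for i j
  \<comment> \<open>The signed error of \<open>T\<close> on a test function at \<open>z\<close>; its
    size is at most \<eta>, uniformly in \<open>z\<close>.\<close>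
  define r where "r i j = apply_bcontfun (T (test_fun i j)) z - a ^ i * b ^ j" for i j
  have r: "\<bar>r i j\<bar> \<le> \<eta> i j" for i j
    using norm_bounded[of "T (test_fun i j) - test_fun i j" z]
    by (simp add: r_def \<eta>_def z a_def b_def apply_test_fun minus_bcontfun.rep_eq)
  have \<eta>: "0 \<le> \<eta> i j" for i j
    by (simp add: \<eta>_def)
  define M where "M = apply_bcontfun F z"
  have M: "\<bar>M\<bar> \<le> norm F"
    using norm_bounded[of F z] by (simp add: M_def)
  define c where "c = \<epsilon> + K * (a\<^sup>2 + b\<^sup>2)"
  \<comment> \<open>The bound \<epsilon> + K * ((squash u - a)^2 + (squash v - b)^2) as a function
    of (u, v), expanded in the test functions; \<open>c\<close> collects its constant terms.\<close>
  define g where "g = c *\<^sub>R test_fun 0 0 + (- (2 * K * a)) *\<^sub>R test_fun 1 0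
    + (- (2 * K * b)) *\<^sub>R test_fun 0 1 + K *\<^sub>R test_fun 2 0 + K *\<^sub>R test_fun 0 2"
  note sub = subspace_add[OF D] subspace_diff[OF D] subspace_scale[OF D]
  have "\<bar>apply_bcontfun (F - M *\<^sub>R test_fun 0 0) w\<bar> \<le> apply_bcontfun g w" for w
  proof -
    obtain u v where w: "w = (u, v)" by fastforce
    show ?thesis
      using le[of u v x y]
      by (simp add: g_def c_def w apply_test_fun plus_bcontfun.rep_eq minus_bcontfun.rep_eq
          scaleR_bcontfun.rep_eq M_def z a_def b_def power2_eq_square algebra_simps)
  qed
  then have "\<bar>apply_bcontfun (T (F - M *\<^sub>R test_fun 0 0)) z\<bar> \<le> apply_bcontfun (T g) z"
    using F e by (intro pos_linear_on_abs_le[OF T D]) (auto simp: g_def intro!: sub)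
  also have "T (F - M *\<^sub>R test_fun 0 0) = T F - M *\<^sub>R T (test_fun 0 0)"
    using F e by (simp add: pos_linear_on_diff[OF T D] pos_linear_on_scaleR[OF T] sub)
  \<comment> \<open>Keeping the minus signs inside the scalars lets the homogeneity rule match each
    summand.\<close>
  also have "T g = c *\<^sub>R T (test_fun 0 0) + (- (2 * K * a)) *\<^sub>R T (test_fun 1 0)
    + (- (2 * K * b)) *\<^sub>R T (test_fun 0 1) + K *\<^sub>R T (test_fun 2 0) + K *\<^sub>R T (test_fun 0 2)"
    unfolding g_def using e
    by (simp add: pos_linear_on_add[OF T] pos_linear_on_scaleR[OF T] sub del: scaleR_minus_left)
  \<comment> \<open>Since \<open>g\<close> takes the value \<epsilon> at \<open>z\<close>, the exact
    parts a^i * b^j of the five terms sum to \<epsilon>, and only the errors \<open>r\<close>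
    remain.\<close>
  also have "apply_bcontfun \<dots> z = \<epsilon> + c * r 0 0 - 2 * K * a * r 1 0 - 2 * K * b * r 0 1
      + K * r 2 0 + K * r 0 2"
    by (simp add: r_def c_def plus_bcontfun.rep_eq scaleR_bcontfun.rep_eq
        power2_eq_square algebra_simps)
  finally have main: "\<bar>apply_bcontfun (T F) z - M - M * r 0 0\<bar>
      \<le> \<epsilon> + c * r 0 0 - 2 * K * a * r 1 0 - 2 * K * b * r 0 1 + K * r 2 0 + K * r 0 2"
    by (simp add: r_def minus_bcontfun.rep_eq scaleR_bcontfun.rep_eq algebra_simps)
  have est: "\<bar>d * r i j\<bar> \<le> C * \<eta> i j" if "\<bar>d\<bar> \<le> C" for d C i j
    unfolding abs_mult using that by (intro mult_mono r) auto
  have c: "\<bar>c\<bar> \<le> \<epsilon> + 2 * K"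
  proof -
    have "a\<^sup>2 \<le> 1" "b\<^sup>2 \<le> 1"
      using ab by (auto intro: power_le_one)
    then have "K * (a\<^sup>2 + b\<^sup>2) \<le> K * 2"
      using \<open>0 \<le> K\<close> by (intro mult_left_mono) auto
    then show ?thesis
      using \<open>0 \<le> \<epsilon>\<close> \<open>0 \<le> K\<close> by (simp add: c_def)
  qed
  have Kab: "\<bar>2 * K * a\<bar> \<le> 2 * K" "\<bar>2 * K * b\<bar> \<le> 2 * K" "\<bar>K\<bar> \<le> K"
    using ab \<open>0 \<le> K\<close> by (auto simp: abs_mult mult_left_le)
  \<comment> \<open>\<open>T\<close> need not fix the constant function \<open>M\<close>; correcting
    for this costs \<open>M * r 0 0\<close>, which is where \<open>norm F\<close> enters the
    constant.\<close>
  have "\<bar>apply_bcontfun (T F) z - M\<bar>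
      \<le> \<bar>apply_bcontfun (T F) z - M - M * r 0 0\<bar> + \<bar>M * r 0 0\<bar>"
    using abs_triangle_ineq[of "apply_bcontfun (T F) z - M - M * r 0 0" "M * r 0 0"] by simp
  also have "\<dots> \<le> \<epsilon> + (\<epsilon> + 2 * K + norm F) * \<eta> 0 0
      + 2 * K * \<eta> 1 0 + 2 * K * \<eta> 0 1 + K * \<eta> 2 0 + K * \<eta> 0 2"
    using main est[OF M, of 0 0] abs_le_D1[OF est[OF c, of 0 0]]
      abs_le_D2[OF est[OF Kab(1), of 1 0]] abs_le_D2[OF est[OF Kab(2), of 0 1]]
      abs_le_D1[OF est[OF Kab(3), of 2 0]] abs_le_D1[OF est[OF Kab(3), of 0 2]]
      distrib_right[of "\<epsilon> + 2 * K" "norm F" "\<eta> 0 0"] by linarith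
  \<comment> \<open>Each coefficient is enlarged to the common constant so that the errors gather
    into one sum.\<close>
  also have "\<dots> \<le> \<epsilon> + ?C * \<eta> 0 0 + ?C * \<eta> 1 0 + ?C * \<eta> 0 1 + ?C * \<eta> 2 0 + ?C * \<eta> 0 2"
    using \<open>0 \<le> \<epsilon>\<close> \<open>0 \<le> K\<close> by (intro add_mono mult_right_mono \<eta>) auto
  finally show "norm (apply_bcontfun (T F - F) z) \<le> \<epsilon> + ?C * ?S"
    by (simp add: \<eta>_def M_def minus_bcontfun.rep_eq distrib_left)
qed

theorem theorem3p2:
  fixes p\<^sub>1 p\<^sub>2 q\<^sub>1 q\<^sub>2 :: "nat \<Rightarrow> real"
    and \<omega> :: "real \<Rightarrow> real"
    and D :: "CB set"
    and A :: "nat \<Rightarrow> nat \<Rightarrow> CB \<Rightarrow> CB"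
  assumes "\<And>n. n \<ge> 1 \<Longrightarrow> 0 < q\<^sub>1 n \<and> q\<^sub>1 n < p\<^sub>1 n \<and> p\<^sub>1 n \<le> 1"
    and "\<And>n. n \<ge> 1 \<Longrightarrow> 0 < q\<^sub>2 n \<and> q\<^sub>2 n < p\<^sub>2 n \<and> p\<^sub>2 n \<le> 1"
    and "p\<^sub>1 \<longlonglongrightarrow> 1" and "q\<^sub>1 \<longlonglongrightarrow> 1"
    and "p\<^sub>2 \<longlonglongrightarrow> 1" and "q\<^sub>2 \<longlonglongrightarrow> 1"
    and "modulus_type \<omega>"
    and "subspace D"
    and "Bcontfun ` H \<omega> \<subseteq> D"
    and "{test_fun 0 0, test_fun 1 0, test_fun 0 1, test_fun 2 0, test_fun 0 2} \<subseteq> D"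
    and "\<And>n\<^sub>1 n\<^sub>2. n\<^sub>1 \<ge> 1 \<Longrightarrow> n\<^sub>2 \<ge> 1 \<Longrightarrow> pos_linear_on D (A n\<^sub>1 n\<^sub>2)"
    and "((\<lambda>(n\<^sub>1, n\<^sub>2). norm (A n\<^sub>1 n\<^sub>2 (test_fun 0 0) - test_fun 0 0)) \<longlongrightarrow> 0)
           (sequentially \<times>\<^sub>F sequentially)"
    and "((\<lambda>(n\<^sub>1, n\<^sub>2). norm (A n\<^sub>1 n\<^sub>2 (test_fun 1 0) - test_fun 1 0)) \<longlongrightarrow> 0)
           (sequentially \<times>\<^sub>F sequentially)"
    and "((\<lambda>(n\<^sub>1, n\<^sub>2). norm (A n\<^sub>1 n\<^sub>2 (test_fun 0 1) - test_fun 0 1)) \<longlongrightarrow> 0)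
           (sequentially \<times>\<^sub>F sequentially)"
    and "((\<lambda>(n\<^sub>1, n\<^sub>2). norm (A n\<^sub>1 n\<^sub>2 (test_fun 2 0) - test_fun 2 0)) \<longlongrightarrow> 0)
           (sequentially \<times>\<^sub>F sequentially)"
    and "((\<lambda>(n\<^sub>1, n\<^sub>2). norm (A n\<^sub>1 n\<^sub>2 (test_fun 0 2) - test_fun 0 2)) \<longlongrightarrow> 0)
           (sequentially \<times>\<^sub>F sequentially)"
  shows "\<forall>f \<in> H \<omega>.
    ((\<lambda>(n\<^sub>1, n\<^sub>2). norm (A n\<^sub>1 n\<^sub>2 (Bcontfun f) - Bcontfun f)) \<longlongrightarrow> 0)
      (sequentially \<times>\<^sub>F sequentially)"
proof
  fix f assume f: "f \<in> H \<omega>"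
  define F where "F = Bcontfun f"
  have F: "apply_bcontfun F = f"
    using H_subset_bcontfun[OF \<open>modulus_type \<omega>\<close>] f by (auto simp: F_def Bcontfun_inverse)
  define S where "S = (\<lambda>(m, n).
    norm (A m n (test_fun 0 0) - test_fun 0 0) + norm (A m n (test_fun 1 0) - test_fun 1 0)
      + norm (A m n (test_fun 0 1) - test_fun 0 1) + norm (A m n (test_fun 2 0) - test_fun 2 0)
      + norm (A m n (test_fun 0 2) - test_fun 0 2))"
  let ?L = "sequentially \<times>\<^sub>F sequentially"
  have S: "(S \<longlongrightarrow> 0) ?L"
    using tendsto_add[OF tendsto_add[OF tendsto_add[OF tendsto_add[OF assms(12,13)] assms(14)]
      assms(15)] assms(16)]
    by (simp add: S_def case_prod_unfold)
  \<comment> \<open>Positivity and linearity are assumed for indices from 1 on, so index 0 is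
    discarded.\<close>
  have ev: "eventually (\<lambda>(m, n). 1 \<le> m \<and> 1 \<le> n) ?L"
    unfolding eventually_prod_sequentially by auto
  have "eventually (\<lambda>(m, n). norm (A m n F - F) < e) ?L" if "0 < e" for e
  proof -
    \<comment> \<open>\<open>K\<close> is fixed by \<open>e\<close> before the indices vary; hence
      the estimate tends to \<open>e / 2\<close>, leaving a margin of \<open>e / 2\<close> for the
      errors.\<close>
    obtain K where "0 \<le> K" and K: "\<And>u v x y. \<bar>f (u, v) - f (x, y)\<bar>
        \<le> e / 2 + K * ((squash u - squash x)\<^sup>2 + (squash v - squash y)\<^sup>2)"
      using H_quadratic_bound[OF \<open>modulus_type \<omega>\<close> f, of "e / 2"] \<open>0 < e\<close> by auto
    let ?C = "e / 2 + 2 * K + norm F"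
    have "((\<lambda>i. e / 2 + ?C * S i) \<longlongrightarrow> e / 2 + ?C * 0) ?L"
      by (intro tendsto_intros S)
    then have "eventually (\<lambda>i. e / 2 + ?C * S i < e) ?L"
      using \<open>0 < e\<close> by (auto dest!: order_tendstoD(2)[where a = e])
    with ev show ?thesis
    proof eventually_elim
      case (elim i)
      obtain m n where i: "i = (m, n)" by fastforce
      have "norm (A m n F - F) \<le> e / 2 + ?C * S (m, n)"
        unfolding S_def prod.case
      proof (rule pos_linear_on_korovkin_estimate)
        show "pos_linear_on D (A m n)"
          using assms(11) elim by (simp add: i)
      qed (use assms(8-10) f K F \<open>0 \<le> K\<close> \<open>0 < e\<close> in \<open>auto simp: F_def\<close>)
      with elim show ?case by (simp add: i)
    qed
  qed
  then show "((\<lambda>(m, n). norm (A m n (Bcontfun f) - Bcontfun f)) \<longlongrightarrow> 0) ?L"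
    by (simp add: tendsto_iff F_def case_prod_unfold)
qed

end
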